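(* Fix integers $s,t\ge 3$ with $R(s-1,t)\ge R(s,t-1)$, and set $M=R(s-1,t)$ and $m=R(s,t-1)$. Let $0<\varepsilon<\frac{1}{M+1}$ and set $\alpha=\frac{1}{M+1}-\varepsilon$. Then there exists a positive integer $n$ such that $\alpha n$ is an integer and every red/blue edge-coloring of the Kneser graph $\mathrm{KG}(n,\alpha n)$ contains a red $K_s$ or a blue $K_t$.
   Context: $R(a,b)$ is the classical Ramsey number: the least $n$ such that every red/blue edge-coloring of $K_n$ contains a red $K_a$ or a blue $K_b$. The Kneser graph $\mathrm{KG}(n,r)$ has vertex set the $r$-element subsets of $[n]=\{1,\dots,n\}$, with two sets adjacent iff they are disjoint. A red $K_s$ is a set of $s$ pairwise adjacent vertices all of whose connecting edges are red; similarly for a blue $K_t$.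
   Formalization: The number ε is additionally assumed to be rational; for irrational ε, α is irrational and no positive integer n makes αn an integer, so the claim fails as literally stated. *)

theory Defs
  imports Complex_Main "HOL-Library.Ramsey"
begin

datatype colour = Red | Blue

text \<open>
  A graph is given by its vertex set \<open>V\<close> and its set \<open>E\<close> of two-element edges. A colouring is
  a total function on sets of vertices, of which only the values on \<open>E\<close> matter.
\<close>

definition mono_clique ::
    "'a set \<Rightarrow> 'a set set \<Rightarrow> ('a set \<Rightarrow> colour) \<Rightarrow> colour \<Rightarrow> nat \<Rightarrow> 'a set \<Rightarrow> bool" where
  "mono_clique V E col c k K \<longleftrightarrow> K \<in> nsets V k \<and> clique K {e \<in> E. col e = c}"

definition arrows :: "'a set \<Rightarrow> 'a set set \<Rightarrow> nat \<Rightarrow> nat \<Rightarrow> bool" where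
  "arrows V E s t \<longleftrightarrow>
     (\<forall>col. (\<exists>K. mono_clique V E col Red s K) \<or> (\<exists>K. mono_clique V E col Blue t K))"

definition ramsey_number :: "nat \<Rightarrow> nat \<Rightarrow> nat" where
  "ramsey_number a b = (LEAST n. arrows {1..n} (nsets {1..n} 2) a b)"

definition kneser_verts :: "nat \<Rightarrow> nat \<Rightarrow> nat set set" where
  "kneser_verts n r = nsets {1..n} r"

text \<open>The condition \<open>A \<noteq> B\<close> only matters for \<open>r = 0\<close>, where it excludes a loop.\<close>

definition kneser_edges :: "nat \<Rightarrow> nat \<Rightarrow> nat set set set" where
  "kneser_edges n r =
     {{A, B} | A B. A \<in> kneser_verts n r \<and> B \<in> kneser_verts n r \<and> A \<noteq> B \<and> A \<inter> B = {}}"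

text \<open>By Ramsey's theorem the \<open>LEAST\<close> above ranges over a nonempty set.\<close>

lemma arrows_ramsey_number:
  "arrows {1..ramsey_number a b} (nsets {1..ramsey_number a b} 2) a b"
proof -
  obtain N :: nat where N: "N \<ge> 1"
    "\<And>(V :: nat set) E. finite V \<Longrightarrow> card V \<ge> N \<Longrightarrow>
       (\<exists>R \<subseteq> V. card R = a \<and> clique R E \<or> card R = b \<and> indep R E)"
    using ramsey2[of a b] by metis
  have "arrows {1..N} (nsets {1..N} 2) a b"
    unfolding arrows_def
  proof
    fix col :: "nat set \<Rightarrow> colour"
    obtain R where R: "R \<subseteq> {1..N}"
      "card R = a \<and> clique R {e. col e = Red} \<or> card R = b \<and> indep R {e. col e = Red}"
      using N(2)[of "{1..N}" "{e. col e = Red}"] by auto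
    have fin: "finite R" using R(1) finite_subset by blast
    have blue: "col e = Blue" if "col e \<noteq> Red" for e
      using that by (cases "col e") auto
    from R(2) show "(\<exists>K. mono_clique {1..N} (nsets {1..N} 2) col Red a K) \<or>
        (\<exists>K. mono_clique {1..N} (nsets {1..N} 2) col Blue b K)"
    proof
      assume "card R = a \<and> clique R {e. col e = Red}"
      then have "mono_clique {1..N} (nsets {1..N} 2) col Red a R"
        using R(1) fin by (auto simp: mono_clique_def clique_def nsets_def[of _ a])
      then show ?thesis by blast
    next
      assume "card R = b \<and> indep R {e. col e = Red}"
      then have "mono_clique {1..N} (nsets {1..N} 2) col Blue b R"
        using R(1) fin blue
        by (auto simp: mono_clique_def clique_def indep_def nsets_def[of _ b])
      then show ?thesis by blast
    qed
  qed
  then show ?thesis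
    unfolding ramsey_number_def by (rule LeastI)
qed

end

theory Submission
  imports Defs
begin

text \<open>
  Fix a vertex \<open>x\<close> and colour each \<open>r\<close>-set \<open>B\<close> disjoint from \<open>x\<close> by the colour of the edge from
  \<open>x\<close> to \<open>B\<close>. If this two-colouring of sets has \<open>M\<close> pairwise disjoint sets of one colour, they form
  a clique joined to \<open>x\<close> monochromatically, and the definition of \<open>M\<close> or \<open>m\<close> gives the result.
  Such sets exist on \<open>M (r + 1) - 1\<close> points: unless the colouring is constant, two \<open>r\<close>-sets of
  different colours share \<open>r - 1\<close> points; delete their union of \<open>r + 1\<close> points, find \<open>M - 1\<close> sets in
  the remainder inductively, and add whichever of the two has the right colour. Since
  \<open>\<alpha> < 1 / (M + 1)\<close>, the \<open>n - r\<close> points outside \<open>x\<close> suffice once \<open>n\<close> is large.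
\<close>

text \<open>Exchange one point of \<open>A - B\<close> for one of \<open>B - A\<close> at a time:
  two consecutive sets have only \<open>r + 1\<close> points in their union, so \<open>f\<close>
  never changes on the way to \<open>B\<close>.\<close>

lemma constant_on_nsets:
  assumes step: "\<And>A B. \<lbrakk>A \<in> nsets W r; B \<in> nsets W r; card (A \<union> B) \<le> Suc r\<rbrakk> \<Longrightarrow> f A = f B"
    and "A \<in> nsets W r" "B \<in> nsets W r"
  shows "f A = f B"
  using assms(2)
proof (induction "card (A - B)" arbitrary: A rule: less_induct)
  case less
  have A: "A \<subseteq> W" "finite A" "card A = r" and B: "B \<subseteq> W" "finite B" "card B = r"
    using less.prems assms(3) by (auto simp: nsets_def)
  show ?case
  proof (cases "A = B")
    case False
    have "\<not> A \<subseteq> B" "\<not> B \<subseteq> A"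
      using False A B by (auto dest: card_subset_eq)
    then obtain a b where a: "a \<in> A" "a \<notin> B" and b: "b \<in> B" "b \<notin> A"
      by blast
    define A' where "A' = insert b (A - {a})"
    have "card A' = Suc (card (A - {a}))"
      unfolding A'_def using A b by simp
    also have "\<dots> = r"
      using A a by (metis card.remove)
    finally have A': "A' \<in> nsets W r"
      using A B b unfolding A'_def by (auto simp: nsets_def)
    have "card (A' - B) < card (A - B)"
      by (rule psubset_card_mono) (use A a b in \<open>auto simp: A'_def\<close>)
    then have "f A' = f B"
      using less.hyps A' by blast
    moreover have "A \<union> A' = insert b A"
      using a by (auto simp: A'_def)
    then have "card (A \<union> A') \<le> Suc r"
      using A b by simp
    then have "f A = f A'"
      using step less.prems A' by blast
    ultimately show ?thesis by simp
  qed simp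
qed

text \<open>Each new set costs at most \<open>r + 1\<close> points, but the last one needs only its
  own \<open>r\<close>; hence \<open>Suc (card W)\<close> in the bound.\<close>

lemma monochromatic_matching:
  fixes f :: "'a set \<Rightarrow> colour"
  assumes "finite W" "0 < r" "k * Suc r \<le> Suc (card W)"
  shows "\<exists>c. \<exists>F \<in> nsets (nsets W r) k. pairwise disjnt F \<and> (\<forall>A \<in> F. f A = c)"
  using assms(1,3)
proof (induction k arbitrary: W)
  case 0
  show ?case by (intro exI bexI[of _ "{}"]) (auto simp: nsets_def)
next
  case (Suc k)
  \<comment> \<open>\<open>U\<close> is the block deleted before the induction hypothesis is
    applied: \<open>A \<union> B\<close> for two sets of different colours, \<open>A\<close> alone
    if \<open>f\<close> is constant.\<close>
  have extend: "\<exists>F \<in> nsets (nsets W r) (Suc k). pairwise disjnt F \<and> (\<forall>A \<in> F. f A = c)"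
    if F: "F \<in> nsets (nsets (W - U) r) k" "pairwise disjnt F" "\<forall>B \<in> F. f B = c"
      and A: "A \<in> nsets W r" "A \<subseteq> U" "f A = c" for F U A c
  proof (intro bexI conjI)
    have disj: "A \<inter> B = {}" if "B \<in> F" for B
      using that F(1) A(2) by (auto simp: nsets_def)
    \<comment> \<open>A nonempty set disjoint from all members of \<open>F\<close> is not one of
      them, so the family really grows.\<close>
    have "A \<noteq> {}"
      using A(1) \<open>0 < r\<close> by (auto simp: nsets_def)
    then have "A \<notin> F" using disj by blast
    then show "insert A F \<in> nsets (nsets W r) (Suc k)"
      using F(1) A(1) by (auto simp: nsets_def)
    show "pairwise disjnt (insert A F)"
      using disj F(2) by (auto simp: pairwise_insert disjnt_def)
    show "\<forall>B \<in> insert A F. f B = c"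
      using F(3) A(3) by simp
  qed
  have IH: "\<exists>c. \<exists>F \<in> nsets (nsets (W - U) r) k. pairwise disjnt F \<and> (\<forall>B \<in> F. f B = c)"
    if "U \<subseteq> W" "card U \<le> Suc r" for U
  proof (rule Suc.IH)
    show "finite (W - U)" using Suc.prems by simp
    have "card (W - U) = card W - card U"
      using that Suc.prems by (meson card_Diff_subset finite_subset)
    then show "k * Suc r \<le> Suc (card (W - U))"
      using that Suc.prems by simp
  qed
  show ?case
  proof (cases "\<exists>A \<in> nsets W r. \<exists>B \<in> nsets W r. card (A \<union> B) \<le> Suc r \<and> f A \<noteq> f B")
    case True
    then obtain A B where AB: "A \<in> nsets W r" "B \<in> nsets W r" "card (A \<union> B) \<le> Suc r" "f A \<noteq> f B"
      by blast
    then have "A \<union> B \<subseteq> W" by (auto simp: nsets_def)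
    then obtain c F where F: "F \<in> nsets (nsets (W - (A \<union> B)) r) k" "pairwise disjnt F" "\<forall>B \<in> F. f B = c"
      using IH AB(3) by blast
    have "f A = c \<or> f B = c"
      using AB(4) by (metis colour.exhaust)
    then show ?thesis
      using extend[OF F AB(1)] extend[OF F AB(2)] by blast
  next
    case False
    then have const: "f A = f B" if "A \<in> nsets W r" "B \<in> nsets W r" for A B
      using constant_on_nsets[of W r f] that by blast
    have "r \<le> card W" using Suc.prems by simp
    then obtain A where A: "A \<in> nsets W r"
      using obtain_subset_with_card_n unfolding nsets_def by blast
    then have "A \<subseteq> W" "card A \<le> Suc r"
      by (auto simp: nsets_def)
    \<comment> \<open>The colour from the induction hypothesis is dropped: constancy gives every
      member the colour of \<open>A\<close>, even when \<open>F\<close> is empty.\<close>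
    then obtain F where F: "F \<in> nsets (nsets (W - A) r) k" "pairwise disjnt F"
      using IH by blast
    have "F \<subseteq> nsets W r"
      using F(1) by (auto simp: nsets_def)
    then have "\<forall>B \<in> F. f B = f A"
      using A const by blast
    then show ?thesis
      using extend[OF F _ A] by blast
  qed
qed

text \<open>Ramsey numbers are defined on \<open>{1..n}\<close> but get applied to families of sets.
  A colouring of \<open>W\<close> is pulled back along \<open>h\<close>, and the clique found is
  pushed forward.\<close>

lemma arrows_complete_bij:
  assumes "arrows V (nsets V 2) a b" "bij_betw h V W"
  shows "arrows W (nsets W 2) a b"
  unfolding arrows_def
proof
  fix col
  have inj: "inj_on h V" and W: "h ` V = W"
    using assms(2) by (auto simp: bij_betw_def)
  have transfer: "mono_clique W (nsets W 2) col c k (h ` K)"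
    if "mono_clique V (nsets V 2) (\<lambda>e. col (h ` e)) c k K" for c k K
    using that inj W
    unfolding mono_clique_def clique_def
    by (auto simp: nsets_def card_image inj_on_subset doubleton_eq_iff card_2_iff)
  show "(\<exists>K. mono_clique W (nsets W 2) col Red a K) \<or> (\<exists>K. mono_clique W (nsets W 2) col Blue b K)"
    using assms(1)[unfolded arrows_def, rule_format, of "\<lambda>e. col (h ` e)"] transfer by blast
qed

text \<open>Passing to a subset of exactly the right size avoids showing that \<open>arrows\<close>
  is monotone in the vertex set.\<close>

lemma arrows_complete_ramsey_number:
  assumes "finite V" "ramsey_number a b \<le> card V"
  obtains U where "U \<subseteq> V" "arrows U (nsets U 2) a b"
proof -
  obtain U where U: "U \<subseteq> V" "card U = ramsey_number a b" "finite U"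
    using obtain_subset_with_card_n[OF assms(2)] by blast
  then obtain h where "bij_betw h {1..ramsey_number a b} U"
    using ex_bij_betw_nat_finite_1 by metis
  then show thesis
    using that U(1) arrows_complete_bij[OF arrows_ramsey_number] by blast
qed

lemma mono_clique_mono:
  assumes "mono_clique U (nsets U 2) col c k K" "U \<subseteq> V" "clique U E"
  shows "mono_clique V E col c k K"
  using assms unfolding mono_clique_def clique_def by (auto simp: nsets_def)

lemma mono_clique_insert:
  assumes "mono_clique V E col c k K" "x \<in> V" "x \<notin> K"
    and "\<And>y. y \<in> K \<Longrightarrow> {x, y} \<in> E \<and> col {x, y} = c"
  shows "mono_clique V E col c (Suc k) (insert x K)"
  using assms unfolding mono_clique_def clique_def
  by (auto simp: nsets_def insert_commute)

lemma kneser_arrows: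
  assumes "0 < r" and n: "r + ramsey_number (s - 1) t * Suc r \<le> Suc n"
    and le: "ramsey_number s (t - 1) \<le> ramsey_number (s - 1) t"
    and "0 < s" "0 < t" "r \<le> n"
  shows "arrows (kneser_verts n r) (kneser_edges n r) s t"
  unfolding arrows_def
proof
  fix col :: "nat set set \<Rightarrow> colour"
  \<comment> \<open>By symmetry any vertex would do. This one leaves the interval
    \<open>{Suc r..n}\<close>, and assumption \<open>n\<close> is exactly the size bound for a
    matching there.\<close>
  define x where "x = {1..r}"
  have x: "x \<in> kneser_verts n r"
    using \<open>r \<le> n\<close> by (auto simp: x_def kneser_verts_def nsets_def)
  have "ramsey_number (s - 1) t * Suc r \<le> Suc (card {Suc r..n})"
    using n \<open>r \<le> n\<close> by simp
  then obtain c F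
    where F: "F \<in> nsets (nsets {Suc r..n} r) (ramsey_number (s - 1) t)" "pairwise disjnt F"
      and c: "\<forall>A \<in> F. col {x, A} = c"
    using monochromatic_matching[of "{Suc r..n}" r _ "\<lambda>A. col {x, A}"] \<open>0 < r\<close> by blast
  have finF: "finite F" and cardF: "card F = ramsey_number (s - 1) t"
    using F(1) by (auto simp: nsets_def)
  have FW: "F \<subseteq> nsets {Suc r..n} r"
    using F(1) by (simp add: nsets_def)
  also have "\<dots> \<subseteq> kneser_verts n r"
    unfolding kneser_verts_def by (rule nsets_mono) auto
  finally have FV: "F \<subseteq> kneser_verts n r" .
  have edgeI: "{A, B} \<in> kneser_edges n r"
    if "A \<in> kneser_verts n r" "B \<in> kneser_verts n r" "A \<noteq> B" "A \<inter> B = {}" for A B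
    using that unfolding kneser_edges_def by blast
  have clique: "clique F (kneser_edges n r)"
    unfolding clique_def
  proof (intro ballI impI)
    fix A B assume "A \<in> F" "B \<in> F" "A \<noteq> B"
    then show "{A, B} \<in> kneser_edges n r"
      using F(2) FV by (intro edgeI) (auto simp: pairwise_def disjnt_def)
  qed
  have disj: "x \<inter> A = {}" if "A \<in> F" for A
  proof -
    have "A \<subseteq> {Suc r..n}"
      using subsetD[OF FW that] by (simp add: nsets_def)
    moreover have "x \<inter> {Suc r..n} = {}"
      by (auto simp: x_def)
    ultimately show ?thesis by blast
  qed
  have "x \<noteq> {}" using \<open>0 < r\<close> by (auto simp: x_def)
  then have xF: "x \<notin> F" using disj by blast
  have edge: "{x, A} \<in> kneser_edges n r" if "A \<in> F" for A
    using that x FV disj xF by (intro edgeI) auto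
  have lift: "mono_clique (kneser_verts n r) (kneser_edges n r) col d k K"
    if "U \<subseteq> F" "mono_clique U (nsets U 2) col d k K" for U d k K
  proof (rule mono_clique_mono[OF that(2)])
    show "U \<subseteq> kneser_verts n r" "clique U (kneser_edges n r)"
      using that(1) FV clique unfolding clique_def by blast+
  qed
  have lift_insert: "mono_clique (kneser_verts n r) (kneser_edges n r) col c (Suc k) (insert x K)"
    if U: "U \<subseteq> F" and K: "mono_clique U (nsets U 2) col c k K" for U k K
  proof (rule mono_clique_insert[OF lift[OF U K] x])
    have "K \<subseteq> F"
      using U K by (auto simp: mono_clique_def nsets_def)
    then show "x \<notin> K" "\<And>y. y \<in> K \<Longrightarrow> {x, y} \<in> kneser_edges n r \<and> col {x, y} = c"
      using xF edge c by auto
  qed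
  show "(\<exists>K. mono_clique (kneser_verts n r) (kneser_edges n r) col Red s K) \<or>
      (\<exists>K. mono_clique (kneser_verts n r) (kneser_edges n r) col Blue t K)"
  proof (cases c)
    case Red
    \<comment> \<open>A blue clique of size \<open>t\<close> inside \<open>F\<close> is enough by
      itself; a red one of size \<open>s - 1\<close> is completed by \<open>x\<close>.\<close>
    obtain U where U: "U \<subseteq> F" "arrows U (nsets U 2) (s - 1) t"
      by (rule arrows_complete_ramsey_number[OF finF]) (use cardF in auto)
    from U(2) have "(\<exists>K. mono_clique U (nsets U 2) col Red (s - 1) K) \<or>
        (\<exists>K. mono_clique U (nsets U 2) col Blue t K)"
      unfolding arrows_def ..
    then show ?thesis
      using lift[OF U(1)] lift_insert[OF U(1), of "s - 1"] Red \<open>0 < s\<close> by simp blast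
  next
    case Blue
    obtain U where U: "U \<subseteq> F" "arrows U (nsets U 2) s (t - 1)"
      by (rule arrows_complete_ramsey_number[OF finF]) (use cardF le in auto)
    from U(2) have "(\<exists>K. mono_clique U (nsets U 2) col Red s K) \<or>
        (\<exists>K. mono_clique U (nsets U 2) col Blue (t - 1) K)"
      unfolding arrows_def ..
    then show ?thesis
      using lift[OF U(1)] lift_insert[OF U(1), of "t - 1"] Blue \<open>0 < t\<close> by simp blast
  qed
qed

theorem theorem2p1:
  fixes s t M m :: nat and \<epsilon> \<alpha> :: real
  assumes "s \<ge> 3" and "t \<ge> 3"
    and "M = ramsey_number (s - 1) t"
    and "m = ramsey_number s (t - 1)"
    and "M \<ge> m"
    and "0 < \<epsilon>" and "\<epsilon> < 1 / (real M + 1)"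
    and "\<epsilon> \<in> \<rat>"
    and "\<alpha> = 1 / (real M + 1) - \<epsilon>"
  shows "\<exists>n r :: nat. n > 0 \<and> real r = \<alpha> * real n \<and>
           arrows (kneser_verts n r) (kneser_edges n r) s t"
proof -
  \<comment> \<open>An integral value of \<alpha> n with n > 0 requires \<alpha> to be rational;
    conversely, a fraction p/q for \<alpha> supplies \<open>n\<close> and \<open>r\<close> as a
    common multiple of \<open>q\<close> and \<open>p\<close>.\<close>
  have "\<alpha> \<in> \<rat>" "0 < \<alpha>"
    using assms by auto
  then obtain p q where q: "q \<noteq> 0" and "\<bar>\<alpha>\<bar> = real p / real q"
    using Rats_abs_nat_div_natE by metis
  then have pq: "\<alpha> = real p / real q"
    using \<open>0 < \<alpha>\<close> by simp
  have p: "0 < p"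
    using \<open>0 < \<alpha>\<close> pq by (auto intro: Nat.gr0I)
  have "real p / real q < 1 / (real M + 1)"
    using assms pq by simp
  then have "real (p * (M + 1)) < real q"
    using q by (simp add: field_simps)
  then have "Suc (p * (M + 1)) \<le> q"
    by (simp only: of_nat_less_iff Suc_le_eq)
  \<comment> \<open>Integrality made the strict inequality a gap of at least 1. Scaling by
    \<open>M + 1\<close> widens it to \<open>M + 1\<close>, which covers the extra \<open>M\<close>
    points in the matching bound for r = p (M + 1), n = q (M + 1).\<close>
  then have "Suc (p * (M + 1)) * (M + 1) \<le> q * (M + 1)"
    by (rule mult_le_mono1)
  then have n: "p * (M + 1) + M * Suc (p * (M + 1)) \<le> Suc (q * (M + 1))"
    and "p * (M + 1) \<le> q * (M + 1)"
    by (simp_all add: algebra_simps)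
  then have "arrows (kneser_verts (q * (M + 1)) (p * (M + 1)))
      (kneser_edges (q * (M + 1)) (p * (M + 1))) s t"
    using assms p by (intro kneser_arrows) auto
  moreover have "real (p * (M + 1)) = \<alpha> * real (q * (M + 1))"
    using pq q by (simp add: field_simps)
  moreover have "0 < q * (M + 1)"
    using q by simp
  ultimately show ?thesis by blast
qed

end
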